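(* Let $\mathcal B_1$ and $\mathcal B_2$ be subbases of a density basis $\mathcal B$ formed of open sets from $\mathbb R^n$. If the bases $\mathcal B_1$ and $\mathcal B_2$ are quasi-equivalent with respect to $\mathcal B$, then $$\mathcal F^+(\mathcal B_1)=\mathcal F^+(\mathcal B_2).$$
   Context: A differentiation basis (or basis) in $\mathbb R^n$ is a family $\mathcal B$ of bounded sets of positive measure such that for any $x\in\mathbb R^n$ there is a sequence $E_k\in\mathcal B$ with $x\in E_k$ and $\mathrm{diam}(E_k)\to0$. A subbasis of $\mathcal B$ is a basis contained in $\mathcal B$. For $f\in L_{\rm loc}(\mathbb R^n)$ (locally integrable), $$\delta_{\mathcal B}(x,f)=\limsup_{\mathrm{diam}(E)\to0,\ x\in E\in\mathcal B}\left|\frac1{|E|}\int_Ef(t)\,dt-f(x)\right| ,$$ $$\mathcal F^+(\mathcal B)=\{f\in L_{\rm loc}(\mathbb R^n):\ f\ge0,\ \delta_{\mathcal B}(x,f)=0\text{ for almost every }x\}.$$ $\mathcal B$ is a density basis if for every measurable set $E$ one has $\delta_{\mathcal B}(x,\mathbb I_E)=0$ for almost every $x\in\mathbb R^n$, where $\mathbb I_E$ is the indicator function. For bases $\mathcal B_1,\mathcal B_2\subseteq\mathcal B$: $\mathcal B_2$ is quasi-coverable by $\mathcal B_1$ (with respect to $\mathcal B$) if for any $R\in\mathcal B_2$ there exist $R_k\in\mathcal B_1$, $k=1,\dots,p$, and $R'\in\mathcal B$ such that, with $\tilde R=\bigcup_{k=1}^pR_k$, $$R\subseteq\tilde R\subseteq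 R',\qquad \mathrm{diam}(R')\le c\cdot\mathrm{diam}(R),\qquad |R'|\le c|R_k|\ (k=1,\dots,p),$$ $$\sum_{k=1}^p|R_k|\le c|\tilde R|,\qquad |\tilde R|\le c|R|,$$ where the constant $c\ge1$ depends only on the bases $\mathcal B_1,\mathcal B_2,\mathcal B$. Two bases are quasi-equivalent (with respect to $\mathcal B$) if each is quasi-coverable by the other. *)

theory Defs
  imports "HOL-Analysis.Analysis"
begin

definition differentiation_basis :: "'a::euclidean_space set set \<Rightarrow> bool" where
  "differentiation_basis \<B> \<longleftrightarrow>
     (\<forall>E\<in>\<B>. bounded E \<and> E \<in> sets lebesgue \<and> measure lebesgue E > 0) \<and>
     (\<forall>x. \<exists>E :: nat \<Rightarrow> 'a set.
        (\<forall>k. E k \<in> \<B> \<and> x \<in> E k) \<and> (\<lambda>k. diameter (E k)) \<longlonglongrightarrow> 0)"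

definition subbasis :: "'a::euclidean_space set set \<Rightarrow> 'a set set \<Rightarrow> bool" where
  "subbasis \<B>' \<B> \<longleftrightarrow> differentiation_basis \<B>' \<and> \<B>' \<subseteq> \<B>"

definition locally_integrable :: "('a::euclidean_space \<Rightarrow> real) \<Rightarrow> bool" where
  "locally_integrable f \<longleftrightarrow> (\<forall>K. compact K \<longrightarrow> set_integrable lebesgue K f)"

definition shrinking :: "'a::euclidean_space set set \<Rightarrow> 'a \<Rightarrow> 'a set filter" where
  "shrinking \<B> x = inf (filtercomap diameter (nhds 0)) (principal {E \<in> \<B>. x \<in> E})"

definition basis_delta :: "'a::euclidean_space set set \<Rightarrow> 'a \<Rightarrow> ('a \<Rightarrow> real) \<Rightarrow> ereal" where
  "basis_delta \<B> x f =
     Limsup (shrinking \<B> x)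
       (\<lambda>E. ereal \<bar>1 / measure lebesgue E * set_lebesgue_integral lebesgue E f - f x\<bar>)"

text \<open>Locally integrable functions are represented by actual functions rather than by
  classes modulo null sets; accordingly \<open>f \<ge> 0\<close> is read almost everywhere, which makes
  membership independent of the representative.\<close>

definition F_plus :: "'a::euclidean_space set set \<Rightarrow> ('a \<Rightarrow> real) set" where
  "F_plus \<B> = {f. locally_integrable f \<and> (AE x in lebesgue. 0 \<le> f x) \<and>
                  (AE x in lebesgue. basis_delta \<B> x f = 0)}"

definition density_basis :: "'a::euclidean_space set set \<Rightarrow> bool" where
  "density_basis \<B> \<longleftrightarrow> differentiation_basis \<B> \<and>
     (\<forall>E\<in>sets lebesgue. AE x in lebesgue. basis_delta \<B> x (indicator E) = 0)"

text \<open>\<open>quasi_coverable \<B> \<B>\<^sub>1 \<B>\<^sub>2\<close>: the basis \<open>\<B>\<^sub>2\<close> is quasi-coverable by \<open>\<B>\<^sub>1\<close> with respect to \<open>\<B>\<close>.\<close>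

definition quasi_coverable ::
  "'a::euclidean_space set set \<Rightarrow> 'a set set \<Rightarrow> 'a set set \<Rightarrow> bool" where
  "quasi_coverable \<B> \<B>\<^sub>1 \<B>\<^sub>2 \<longleftrightarrow>
     (\<exists>c::real. c \<ge> 1 \<and>
       (\<forall>R\<in>\<B>\<^sub>2. \<exists>(p::nat) (Rk :: nat \<Rightarrow> 'a set) R'.
          (\<forall>k\<in>{1..p}. Rk k \<in> \<B>\<^sub>1) \<and> R' \<in> \<B> \<and>
          (let Rt = (\<Union>k\<in>{1..p}. Rk k) in
             R \<subseteq> Rt \<and> Rt \<subseteq> R' \<and>
             diameter R' \<le> c * diameter R \<and>
             (\<forall>k\<in>{1..p}. measure lebesgue R' \<le> c * measure lebesgue (Rk k)) \<and>
             (\<Sum>k=1..p. measure lebesgue (Rk k)) \<le> c * measure lebesgue Rt \<and>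
             measure lebesgue Rt \<le> c * measure lebesgue R)))"

definition quasi_equivalent ::
  "'a::euclidean_space set set \<Rightarrow> 'a set set \<Rightarrow> 'a set set \<Rightarrow> bool" where
  "quasi_equivalent \<B> \<B>\<^sub>1 \<B>\<^sub>2 \<longleftrightarrow> quasi_coverable \<B> \<B>\<^sub>1 \<B>\<^sub>2 \<and> quasi_coverable \<B> \<B>\<^sub>2 \<B>\<^sub>1"

end

theory Submission
  imports Defs
begin

text \<open>
  By symmetry it suffices to bound the means of \<open>f\<close> over \<open>\<B>\<^sub>2\<close> when \<open>\<B>\<^sub>2\<close> is quasi-coverable by \<open>\<B>\<^sub>1\<close>
  and \<open>f \<in> F_plus \<B>\<^sub>1\<close>.

  The lower bound \<open>liminf mean R f \<ge> f x\<close> holds at almost every \<open>x\<close> for a nonnegative \<open>f\<close> and a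
  density basis: if \<open>0 < s < f x\<close>, then typically \<open>x\<close> is a density point of \<open>{f > s}\<close>, and
  \<open>mean R f\<close> is at least \<open>s\<close> times the relative measure of that set in \<open>R\<close>
  (\<open>AE_eventually_less_mean\<close>).  It passes to subbases.

  For the upper bound, let \<open>q > f x\<close>, and split \<open>f = min f q + g\<close>.  The first summand contributes
  at most \<open>q\<close> to a mean.  The second summand is nonnegative, and its means over sets of \<open>\<B>\<^sub>1\<close>
  shrinking to \<open>x\<close> tend to \<open>0\<close>, by the lower bound applied to \<open>min f q\<close>.  Hence, for each
  \<open>\<epsilon> > 0\<close> and some \<open>d > 0\<close>, the point \<open>x\<close> lies in the set \<open>A\<close> of all \<open>y\<close> such that
  \<open>mean E g \<le> \<epsilon>\<close> whenever \<open>y \<in> E \<in> \<B>\<^sub>1\<close> and \<open>diameter E < d\<close>.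

  The sets \<open>R\<^sub>k \<in> \<B>\<^sub>1\<close> that cover a set \<open>R \<in> \<B>\<^sub>2\<close> around \<open>x\<close> need not contain \<open>x\<close>, but each has at
  least \<open>1 / c\<close> of the measure of \<open>R'\<close>.  As \<open>x \<in> R'\<close> is typically a density point of \<open>A\<close> for
  \<open>\<B>\<close>, each \<open>R\<^sub>k\<close> meets \<open>A\<close> once \<open>R\<close> is small, so its mean of \<open>g\<close> is at most \<open>\<epsilon>\<close>.  Summing over
  \<open>k\<close> gives \<open>mean R g \<le> c\<^sup>2 \<epsilon>\<close> (\<open>eventually_mean_le_of_density_point\<close>).  Openness of the sets of \<open>\<B>\<^sub>1\<close>
  makes \<open>A\<close> closed, hence measurable, so that almost all its points are density points.
\<close>

section \<open>Means and convergence along a basis\<close>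

definition mean :: "'a::euclidean_space set \<Rightarrow> ('a \<Rightarrow> real) \<Rightarrow> real" where
  "mean E f = 1 / measure lebesgue E * set_lebesgue_integral lebesgue E f"

lemma eventually_shrinking:
  assumes "differentiation_basis \<B>"
  shows "eventually P (shrinking \<B> x) \<longleftrightarrow>
    (\<exists>d>0. \<forall>E\<in>\<B>. x \<in> E \<longrightarrow> diameter E < d \<longrightarrow> P E)"
proof
  assume "eventually P (shrinking \<B> x)"
  then obtain Q where Q: "eventually Q (nhds 0)"
    and QP: "\<And>E. Q (diameter E) \<Longrightarrow> E \<in> \<B> \<Longrightarrow> x \<in> E \<Longrightarrow> P E"
    by (auto simp: shrinking_def eventually_inf_principal eventually_filtercomap)
  then obtain d where "d > 0" and d: "\<And>t::real. \<bar>t\<bar> < d \<Longrightarrow> Q t"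
    by (auto simp: eventually_nhds_metric dist_real_def)
  have "P E" if "E \<in> \<B>" "x \<in> E" "diameter E < d" for E
  proof -
    have "diameter E \<ge> 0"
      using assms that by (auto simp: differentiation_basis_def intro: diameter_ge_0)
    with that d QP show ?thesis by auto
  qed
  with \<open>d > 0\<close> show "\<exists>d>0. \<forall>E\<in>\<B>. x \<in> E \<longrightarrow> diameter E < d \<longrightarrow> P E" by auto
next
  assume "\<exists>d>0. \<forall>E\<in>\<B>. x \<in> E \<longrightarrow> diameter E < d \<longrightarrow> P E"
  then obtain d where "d > 0" and d: "\<And>E. E \<in> \<B> \<Longrightarrow> x \<in> E \<Longrightarrow> diameter E < d \<Longrightarrow> P E"
    by auto
  then show "eventually P (shrinking \<B> x)"
    unfolding shrinking_def eventually_inf_principal eventually_filtercomap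
    by (intro exI[of _ "\<lambda>t. t < d"]) (auto intro: eventually_nhds_in_open[of "{..<d}", simplified])
qed

lemma eventually_shrinking_mem: "eventually (\<lambda>E. E \<in> \<B>) (shrinking \<B> x)"
  by (simp add: shrinking_def eventually_inf_principal)

lemma shrinking_mono: "\<B>' \<subseteq> \<B> \<Longrightarrow> shrinking \<B>' x \<le> shrinking \<B> x"
  unfolding shrinking_def by (intro inf_mono) auto

lemma shrinking_neq_bot:
  assumes "differentiation_basis \<B>"
  shows "shrinking \<B> x \<noteq> bot"
proof
  assume "shrinking \<B> x = bot"
  then have "eventually (\<lambda>_. False) (shrinking \<B> x)" by simp
  then obtain d where "d > 0" and d: "\<And>E. E \<in> \<B> \<Longrightarrow> x \<in> E \<Longrightarrow> \<not> diameter E < d"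
    using eventually_shrinking[OF assms] by auto
  obtain E where E: "\<And>k::nat. E k \<in> \<B> \<and> x \<in> E k" "(\<lambda>k. diameter (E k)) \<longlonglongrightarrow> 0"
    using assms unfolding differentiation_basis_def by blast
  have "eventually (\<lambda>k. diameter (E k) < d) sequentially"
    using order_tendstoD(2)[OF E(2) \<open>d > 0\<close>] .
  then show False using d E(1) by (auto simp: eventually_sequentially)
qed

text \<open>Nontriviality of the filter matters: the upper limit of \<open>ereal\<close> values along the
  trivial filter would be \<open>-\<infinity>\<close>.\<close>

lemma basis_delta_eq_0_iff:
  assumes "differentiation_basis \<B>"
  shows "basis_delta \<B> x f = 0 \<longleftrightarrow> ((\<lambda>E. mean E f) \<longlongrightarrow> f x) (shrinking \<B> x)"
proof -
  let ?F = "shrinking \<B> x"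
  let ?g = "\<lambda>E. ereal \<bar>mean E f - f x\<bar>"
  have nt: "?F \<noteq> bot" by (rule shrinking_neq_bot[OF assms])
  have "((\<lambda>E. mean E f) \<longlongrightarrow> f x) ?F \<longleftrightarrow> ((\<lambda>E. \<bar>mean E f - f x\<bar>) \<longlongrightarrow> 0) ?F"
    by (metis LIM_zero_iff tendsto_rabs_zero_iff)
  also have "\<dots> \<longleftrightarrow> (?g \<longlongrightarrow> 0) ?F"
    by (metis lim_ereal zero_ereal_def)
  also have "\<dots> \<longleftrightarrow> Limsup ?F ?g = 0"
  proof
    assume "(?g \<longlongrightarrow> 0) ?F"
    then show "Limsup ?F ?g = 0" using lim_imp_Limsup[OF nt] by blast
  next
    assume L: "Limsup ?F ?g = 0"
    have "0 \<le> Liminf ?F ?g" by (rule Liminf_bounded) simp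
    moreover have "Liminf ?F ?g \<le> Limsup ?F ?g" by (rule Liminf_le_Limsup[OF nt])
    ultimately have "Liminf ?F ?g = 0" using L by simp
    then show "(?g \<longlongrightarrow> 0) ?F" using L nt by (simp add: tendsto_iff_Liminf_eq_Limsup)
  qed
  finally show ?thesis by (simp add: basis_delta_def mean_def)
qed

section \<open>Locally integrable functions\<close>

lemma locally_integrable_bounded:
  assumes "locally_integrable f" "bounded E" "E \<in> sets lebesgue"
  shows "set_integrable lebesgue E f"
proof (rule set_integrable_subset)
  show "set_integrable lebesgue (closure E) f"
    using assms by (auto simp: locally_integrable_def compact_closure)
qed (use assms closure_subset in auto)

lemma locally_integrable_measurable:
  fixes f :: "'a::euclidean_space \<Rightarrow> real"
  assumes "locally_integrable f"
  shows "f \<in> borel_measurable lebesgue"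
proof (rule borel_measurable_LIMSEQ_real)
  fix n :: nat
  have "set_integrable lebesgue (cball 0 (real n)) f"
    using assms by (simp add: locally_integrable_def)
  then show "(\<lambda>x. indicator (cball 0 (real n)) x * f x) \<in> borel_measurable lebesgue"
    by (auto simp: set_integrable_def)
next
  fix x :: 'a
  obtain N where N: "norm x \<le> real N" using real_arch_simple by blast
  have "eventually (\<lambda>n. indicator (cball 0 (real n)) x * f x = f x) sequentially"
    using eventually_ge_at_top[of N]
  proof eventually_elim
    case (elim n)
    with N have "norm x \<le> real n" by linarith
    then show ?case by simp
  qed
  then show "(\<lambda>n. indicator (cball 0 (real n)) x * f x) \<longlonglongrightarrow> f x"
    by (rule tendsto_eventually)
qed

lemma locally_integrable_const: "locally_integrable (\<lambda>x. c)"
proof -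
  have "integrable lebesgue (\<lambda>x. indicator K x * c)" if "compact K" for K :: "'a set"
    using lmeasurable_compact[OF that]
    by (intro integrable_mult_left integrable_real_indicator) (auto simp: fmeasurable_def)
  then show ?thesis by (simp add: locally_integrable_def set_integrable_def)
qed

lemma locally_integrable_min:
  fixes f g :: "'a::euclidean_space \<Rightarrow> real"
  assumes "locally_integrable f" "locally_integrable g"
  shows "locally_integrable (\<lambda>x. min (f x) (g x))"
proof -
  have eq: "indicator K x *\<^sub>R min (f x) (g x) = min (indicator K x *\<^sub>R f x) (indicator K x *\<^sub>R g x)"
    for K :: "'a set" and x by (auto simp: indicator_def)
  show ?thesis
    using assms unfolding locally_integrable_def set_integrable_def eq
    by (auto intro: integrable_min)
qed

lemma locally_integrable_diff:
  assumes "locally_integrable f" "locally_integrable g"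
  shows "locally_integrable (\<lambda>x. f x - g x)"
  using assms unfolding locally_integrable_def by (auto intro: set_integral_diff)

section \<open>Properties of means\<close>

context
  fixes E :: "'a::euclidean_space set"
  assumes bounded_E: "bounded E" and sets_E: "E \<in> sets lebesgue"
begin

lemma mean_diff:
  assumes "locally_integrable f" "locally_integrable g"
  shows "mean E (\<lambda>x. f x - g x) = mean E f - mean E g"
  using assms bounded_E sets_E
  by (simp add: mean_def set_integral_diff locally_integrable_bounded right_diff_distrib)

lemma mean_mono_AE:
  assumes "locally_integrable f" "locally_integrable g" "AE x in lebesgue. f x \<le> g x"
  shows "mean E f \<le> mean E g"
proof -
  have "set_lebesgue_integral lebesgue E f \<le> set_lebesgue_integral lebesgue E g"
    by (rule set_integral_mono_AE)
      (use assms bounded_E sets_E in \<open>auto intro: locally_integrable_bounded\<close>)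
  then show ?thesis unfolding mean_def by (intro mult_left_mono) auto
qed

lemma mean_const:
  assumes "measure lebesgue E > 0"
  shows "mean E (\<lambda>x. c) = c"
  using assms bounded_set_imp_lmeasurable[OF bounded_E sets_E]
  by (simp add: mean_def set_lebesgue_integral_def fmeasurable_def)

lemma mean_indicator:
  "mean E (indicator A) = measure lebesgue (E \<inter> A) / measure lebesgue E"
proof -
  have "set_lebesgue_integral lebesgue E (indicator A) = measure lebesgue (E \<inter> A)"
    unfolding set_lebesgue_integral_def by (simp flip: indicator_inter_arith)
  then show ?thesis by (simp add: mean_def)
qed

end

lemma basis_setD:
  assumes "differentiation_basis \<B>" "E \<in> \<B>"
  shows "bounded E" "E \<in> sets lebesgue" "measure lebesgue E > 0"
  using assms by (auto simp: differentiation_basis_def)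

section \<open>The lower bound for a density basis\<close>

text \<open>The means of \<open>u\<close> dominate \<open>s\<close> times the relative measure of \<open>{u > s}\<close>, which tends to \<open>1\<close>
  at almost every point of that set.  Rational levels \<open>s\<close> keep the exceptional set null.\<close>

lemma AE_eventually_less_mean:
  assumes dens: "density_basis \<B>" and u: "locally_integrable u"
    and nonneg: "AE x in lebesgue. 0 \<le> u x"
  shows "AE x in lebesgue. \<forall>r<u x. eventually (\<lambda>E. r < mean E u) (shrinking \<B> x)"
proof -
  have diff: "differentiation_basis \<B>" using dens by (simp add: density_basis_def)
  define S where "S = (\<lambda>s. {y. s < u y})"
  have S: "S s \<in> sets lebesgue" for s
    using borel_measurable_less[OF borel_measurable_const locally_integrable_measurable[OF u], of s]
    by (simp add: S_def)
  have "AE x in lebesgue. \<forall>s::rat. basis_delta \<B> x (indicator (S (of_rat s))) = 0"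
    unfolding AE_all_countable using dens S by (auto simp: density_basis_def)
  then show ?thesis
  proof (eventually_elim, intro allI impI)
    fix x r
    assume x: "\<forall>s::rat. basis_delta \<B> x (indicator (S (of_rat s))) = 0" and r: "r < u x"
    have ev_basis: "eventually (\<lambda>E. E \<in> \<B>) (shrinking \<B> x)" by (rule eventually_shrinking_mem)
    show "eventually (\<lambda>E. r < mean E u) (shrinking \<B> x)"
    proof (cases "r < 0")
      case True
      show ?thesis using ev_basis
      proof eventually_elim
        case (elim E)
        note E = basis_setD[OF diff elim]
        have "mean E (\<lambda>_. 0) \<le> mean E u"
          by (rule mean_mono_AE[OF E(1,2) locally_integrable_const u nonneg])
        with True show ?case using mean_const[OF E, of 0] by simp
      qed
    next
      case False
      obtain s :: rat where s: "r < of_rat s" "of_rat s < u x"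
        using of_rat_dense[OF r] by blast
      let ?s = "of_rat s :: real"
      have "?s > 0" using False s by linarith
      have "((\<lambda>E. mean E (indicator (S ?s))) \<longlongrightarrow> indicator (S ?s) x) (shrinking \<B> x)"
        using x basis_delta_eq_0_iff[OF diff] by blast
      then have "((\<lambda>E. mean E (indicator (S ?s))) \<longlongrightarrow> 1) (shrinking \<B> x)"
        using s by (simp add: S_def)
      moreover have "r / ?s < 1" using s \<open>?s > 0\<close> by simp
      ultimately have "eventually (\<lambda>E. r / ?s < mean E (indicator (S ?s))) (shrinking \<B> x)"
        by (rule order_tendstoD(1))
      with ev_basis show ?thesis
      proof eventually_elim
        case (elim E)
        note E = basis_setD[OF diff elim(1)]
        have lm: "E \<in> lmeasurable" by (rule bounded_set_imp_lmeasurable[OF E(1,2)])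
        have int: "set_integrable lebesgue E (\<lambda>y. ?s * indicator (S ?s) y)"
        proof -
          have "E \<inter> S ?s \<in> lmeasurable" by (rule fmeasurable_Int_fmeasurable[OF lm S])
          then have "integrable lebesgue (\<lambda>y. ?s * indicator (E \<inter> S ?s) y)"
            by (intro integrable_mult_right integrable_real_indicator) (auto simp: fmeasurable_def)
          moreover have "(\<lambda>y. indicator E y *\<^sub>R (?s * indicator (S ?s) y))
              = (\<lambda>y. ?s * indicator (E \<inter> S ?s) y)"
            by (auto simp: indicator_def)
          ultimately show ?thesis by (simp add: set_integrable_def)
        qed
        have "AE y in lebesgue. y \<in> E \<longrightarrow> ?s * indicator (S ?s) y \<le> u y"
          using nonneg by eventually_elim (auto simp: S_def indicator_def)
        then have "set_lebesgue_integral lebesgue E (\<lambda>y. ?s * indicator (S ?s) y)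
            \<le> set_lebesgue_integral lebesgue E u"
          by (intro set_integral_mono_AE int locally_integrable_bounded u E(1,2)) auto
        then have "?s * set_lebesgue_integral lebesgue E (indicator (S ?s))
            \<le> set_lebesgue_integral lebesgue E u" by simp
        then have "1 / measure lebesgue E * (?s * set_lebesgue_integral lebesgue E (indicator (S ?s)))
            \<le> mean E u"
          unfolding mean_def by (rule mult_left_mono) (use E in auto)
        then have "?s * mean E (indicator (S ?s)) \<le> mean E u"
          by (simp add: mean_def mult_ac)
        moreover have "r < ?s * mean E (indicator (S ?s))"
          using elim(2) \<open>?s > 0\<close> by (simp add: field_simps)
        ultimately show ?case by linarith
      qed
    qed
  qed
qed

section \<open>Transfer of upper bounds through quasi-coverings\<close>

definition small_mean_set ::
  "'a::euclidean_space set set \<Rightarrow> ('a \<Rightarrow> real) \<Rightarrow> real \<Rightarrow> real \<Rightarrow> 'a set" where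
  "small_mean_set \<B> g \<epsilon> d = {y. \<forall>E\<in>\<B>. y \<in> E \<longrightarrow> diameter E < d \<longrightarrow> mean E g \<le> \<epsilon>}"

lemma closed_small_mean_set:
  assumes "\<forall>E\<in>\<B>. open E"
  shows "closed (small_mean_set \<B> g \<epsilon> d)"
proof -
  have "- small_mean_set \<B> g \<epsilon> d = \<Union>{E\<in>\<B>. diameter E < d \<and> mean E g > \<epsilon>}"
    by (auto simp: small_mean_set_def not_le)
  also have "open \<dots>" using assms by auto
  finally show ?thesis by (simp add: closed_def)
qed

text \<open>In a small set \<open>R'\<close> around the density point, the complement of \<open>A\<close> is too thin to contain
  a set of measure at least \<open>measure lebesgue R' / c\<close>.\<close>

lemma eventually_meets_of_density_point:
  assumes diff: "differentiation_basis \<B>" and A: "A \<in> sets lebesgue"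
    and dens: "basis_delta \<B> x (indicator A) = 0" and x: "x \<in> A" and c: "c > 0"
  shows "eventually (\<lambda>R'. \<forall>S\<in>sets lebesgue. S \<subseteq> R' \<longrightarrow>
    measure lebesgue R' \<le> c * measure lebesgue S \<longrightarrow> S \<inter> A \<noteq> {}) (shrinking \<B> x)"
proof -
  have "((\<lambda>E. mean E (indicator A)) \<longlongrightarrow> 1) (shrinking \<B> x)"
    using dens x basis_delta_eq_0_iff[OF diff, of x "indicator A"] by simp
  then have "eventually (\<lambda>E. 1 - 1 / c < mean E (indicator A)) (shrinking \<B> x)"
    by (rule order_tendstoD(1)) (use c in simp)
  moreover have "eventually (\<lambda>E. E \<in> \<B>) (shrinking \<B> x)" by (rule eventually_shrinking_mem)
  ultimately show ?thesis
  proof eventually_elim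
    case (elim R')
    note R' = basis_setD[OF diff elim(2)]
    have lm: "R' \<in> lmeasurable" by (rule bounded_set_imp_lmeasurable[OF R'(1,2)])
    show ?case
    proof (intro ballI impI notI)
      fix S
      assume S: "S \<in> sets lebesgue" "S \<subseteq> R'" "measure lebesgue R' \<le> c * measure lebesgue S"
        and disj: "S \<inter> A = {}"
      have "measure lebesgue (R' \<inter> A) \<le> measure lebesgue (R' - S)"
        by (rule measure_mono_fmeasurable)
          (use disj R' A S lm in \<open>auto intro: fmeasurable.Diff fmeasurable_Diff\<close>)
      also have "\<dots> = measure lebesgue R' - measure lebesgue S"
        using S lm R' by (intro measurable_measure_Diff) auto
      also have "\<dots> \<le> (1 - 1 / c) * measure lebesgue R'"
        using S c by (simp add: field_simps)
      finally have "mean R' (indicator A) \<le> 1 - 1 / c"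
        using R' by (simp add: mean_indicator[OF R'(1,2)] divide_le_eq)
      with elim(1) show False by simp
    qed
  qed
qed

text \<open>The integral of \<open>g\<close> over \<open>R\<close> is at most the sum of its integrals over the \<open>R\<^sub>k\<close>, hence at most
  \<open>\<epsilon>\<close> times the total measure of the \<open>R\<^sub>k\<close>, provided that each \<open>R\<^sub>k\<close> has a point in the closed set.
  One factor \<open>c\<close> of the bound pays for the overlap of the \<open>R\<^sub>k\<close>, the other for the excess of their
  union over \<open>R\<close>.\<close>

lemma eventually_mean_le_of_density_point:
  assumes diff: "differentiation_basis \<B>" and op: "\<forall>E\<in>\<B>. open E"
    and B1: "subbasis \<B>\<^sub>1 \<B>" and B2: "subbasis \<B>\<^sub>2 \<B>"
    and quasi: "quasi_coverable \<B> \<B>\<^sub>1 \<B>\<^sub>2"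
  obtains c where "c \<ge> 1"
    and "\<And>g \<epsilon> d x. \<lbrakk>locally_integrable g; \<And>y. 0 \<le> g y; \<epsilon> > 0; d > 0;
      x \<in> small_mean_set \<B>\<^sub>1 g \<epsilon> d;
      basis_delta \<B> x (indicator (small_mean_set \<B>\<^sub>1 g \<epsilon> d)) = 0\<rbrakk>
      \<Longrightarrow> eventually (\<lambda>R. mean R g \<le> c\<^sup>2 * \<epsilon>) (shrinking \<B>\<^sub>2 x)"
proof -
  have diff1: "differentiation_basis \<B>\<^sub>1" "\<B>\<^sub>1 \<subseteq> \<B>" and diff2: "differentiation_basis \<B>\<^sub>2"
    using B1 B2 by (auto simp: subbasis_def)
  obtain c where c: "c \<ge> 1" and cover: "\<forall>R\<in>\<B>\<^sub>2. \<exists>(p::nat) (Rk :: nat \<Rightarrow> 'a set) R'.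
          (\<forall>k\<in>{1..p}. Rk k \<in> \<B>\<^sub>1) \<and> R' \<in> \<B> \<and>
          (let Rt = (\<Union>k\<in>{1..p}. Rk k) in
             R \<subseteq> Rt \<and> Rt \<subseteq> R' \<and>
             diameter R' \<le> c * diameter R \<and>
             (\<forall>k\<in>{1..p}. measure lebesgue R' \<le> c * measure lebesgue (Rk k)) \<and>
             (\<Sum>k=1..p. measure lebesgue (Rk k)) \<le> c * measure lebesgue Rt \<and>
             measure lebesgue Rt \<le> c * measure lebesgue R)"
    using quasi unfolding quasi_coverable_def by blast
  have "eventually (\<lambda>R. mean R g \<le> c\<^sup>2 * \<epsilon>) (shrinking \<B>\<^sub>2 x)"
    if g: "locally_integrable g" "\<And>y. 0 \<le> g y" and pos: "\<epsilon> > 0" "d > 0"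
      and x: "x \<in> small_mean_set \<B>\<^sub>1 g \<epsilon> d"
      and dens: "basis_delta \<B> x (indicator (small_mean_set \<B>\<^sub>1 g \<epsilon> d)) = 0"
    for g \<epsilon> d x
  proof -
    let ?A = "small_mean_set \<B>\<^sub>1 g \<epsilon> d"
    have "closed ?A" using op diff1 by (intro closed_small_mean_set) auto
    then have A: "?A \<in> sets lebesgue" by (simp add: borel_closed)
    have "eventually (\<lambda>R'. \<forall>S\<in>sets lebesgue. S \<subseteq> R' \<longrightarrow>
      measure lebesgue R' \<le> c * measure lebesgue S \<longrightarrow> S \<inter> ?A \<noteq> {}) (shrinking \<B> x)"
      using c by (intro eventually_meets_of_density_point[OF diff A dens x]) auto
    then obtain e where "e > 0" and e: "\<forall>R'\<in>\<B>. x \<in> R' \<longrightarrow> diameter R' < e \<longrightarrow>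
        (\<forall>S\<in>sets lebesgue. S \<subseteq> R' \<longrightarrow>
          measure lebesgue R' \<le> c * measure lebesgue S \<longrightarrow> S \<inter> ?A \<noteq> {})"
      unfolding eventually_shrinking[OF diff] by (elim exE conjE)
    have "mean R g \<le> c\<^sup>2 * \<epsilon>" if R: "R \<in> \<B>\<^sub>2" "x \<in> R" "diameter R < min d e / c" for R
    proof -
      obtain p :: nat and Rk :: "nat \<Rightarrow> 'a set" and R' where Rk: "\<forall>k\<in>{1..p}. Rk k \<in> \<B>\<^sub>1"
        and R': "R' \<in> \<B>"
        and sub: "R \<subseteq> (\<Union>k\<in>{1..p}. Rk k)" "(\<Union>k\<in>{1..p}. Rk k) \<subseteq> R'"
        and diam: "diameter R' \<le> c * diameter R"
        and m1: "\<forall>k\<in>{1..p}. measure lebesgue R' \<le> c * measure lebesgue (Rk k)"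
        and m2: "(\<Sum>k=1..p. measure lebesgue (Rk k)) \<le> c * measure lebesgue (\<Union>k\<in>{1..p}. Rk k)"
        and m3: "measure lebesgue (\<Union>k\<in>{1..p}. Rk k) \<le> c * measure lebesgue R"
        using bspec[OF cover R(1)] unfolding Let_def
        by (elim exE conjE) (rule that; assumption)
      note Rm = basis_setD[OF diff2 R(1)]
      have "x \<in> R'" using R(2) sub by blast
      have small: "diameter R' < min d e"
        using diam R(3) c by (simp add: field_simps)
      have Rk_int: "set_lebesgue_integral lebesgue (Rk k) g \<le> \<epsilon> * measure lebesgue (Rk k)"
        if k: "k \<in> {1..p}" for k
      proof -
        note Rkm = basis_setD[OF diff1(1) bspec[OF Rk k]]
        have "Rk k \<subseteq> R'" using sub(2) k by blast
        then have "Rk k \<inter> ?A \<noteq> {}"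
          using e[rule_format, OF R' \<open>x \<in> R'\<close> _ Rkm(2)] small bspec[OF m1 k] by auto
        then obtain y where y: "y \<in> Rk k" "y \<in> ?A" by auto
        have "diameter (Rk k) \<le> diameter R'"
          using \<open>Rk k \<subseteq> R'\<close> basis_setD(1)[OF diff R'] by (rule diameter_subset)
        then have "mean (Rk k) g \<le> \<epsilon>"
          using y bspec[OF Rk k] small by (auto simp: small_mean_set_def)
        then show ?thesis using Rkm(3) by (simp add: mean_def field_simps)
      qed
      have intk: "set_integrable lebesgue (Rk k) g" if "k \<in> {1..p}" for k
        using basis_setD[OF diff1(1) bspec[OF Rk that]] g(1) by (intro locally_integrable_bounded)
      have intR: "set_integrable lebesgue R g"
        using Rm g(1) by (intro locally_integrable_bounded)
      have "set_lebesgue_integral lebesgue R g \<le> (\<Sum>k=1..p. set_lebesgue_integral lebesgue (Rk k) g)"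
      proof -
        have "indicator R y *\<^sub>R g y \<le> (\<Sum>k=1..p. indicator (Rk k) y *\<^sub>R g y)" for y
        proof (cases "y \<in> R")
          case True
          then obtain k where k: "k \<in> {1..p}" "y \<in> Rk k" using sub by auto
          have "indicator (Rk k) y *\<^sub>R g y \<le> (\<Sum>k=1..p. indicator (Rk k) y *\<^sub>R g y)"
            by (rule member_le_sum) (use k g in auto)
          with k True show ?thesis by simp
        qed (auto intro!: sum_nonneg simp: g)
        then have "(LINT y|lebesgue. indicator R y *\<^sub>R g y)
            \<le> (LINT y|lebesgue. (\<Sum>k=1..p. indicator (Rk k) y *\<^sub>R g y))"
          using intR intk unfolding set_integrable_def
          by (intro integral_mono Bochner_Integration.integrable_sum) auto
        also have "\<dots> = (\<Sum>k=1..p. (LINT y|lebesgue. indicator (Rk k) y *\<^sub>R g y))"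
          using intk unfolding set_integrable_def by (intro Bochner_Integration.integral_sum) auto
        finally show ?thesis by (simp add: set_lebesgue_integral_def)
      qed
      also have "\<dots> \<le> (\<Sum>k=1..p. \<epsilon> * measure lebesgue (Rk k))"
        by (intro sum_mono Rk_int)
      also have "\<dots> = \<epsilon> * (\<Sum>k=1..p. measure lebesgue (Rk k))"
        by (simp add: sum_distrib_left)
      also have "\<dots> \<le> \<epsilon> * (c * (c * measure lebesgue R))"
        using c pos by (intro mult_left_mono order_trans[OF m2] m3) auto
      finally show ?thesis using Rm(3) by (simp add: mean_def field_simps power2_eq_square)
    qed
    moreover have "min d e / c > 0" using pos \<open>e > 0\<close> c by simp
    ultimately show ?thesis unfolding eventually_shrinking[OF diff2] by blast
  qed
  with c that show ?thesis by blast
qed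

section \<open>Inclusion and equality of the classes\<close>

text \<open>Only countably many sets \<open>small_mean_set\<close> are needed, for rational \<open>q\<close> and for \<open>\<epsilon>\<close> and \<open>d\<close> of
  the form \<open>1 / Suc j\<close>, so almost every point is a density point of all those that contain it.\<close>

lemma F_plus_subset_of_quasi_coverable:
  assumes dens: "density_basis \<B>" and op: "\<forall>E\<in>\<B>. open E"
    and B1: "subbasis \<B>\<^sub>1 \<B>" and B2: "subbasis \<B>\<^sub>2 \<B>"
    and quasi: "quasi_coverable \<B> \<B>\<^sub>1 \<B>\<^sub>2"
  shows "F_plus \<B>\<^sub>1 \<subseteq> F_plus \<B>\<^sub>2"
proof
  fix f assume "f \<in> F_plus \<B>\<^sub>1"
  then have f: "locally_integrable f" and nonneg: "AE x in lebesgue. 0 \<le> f x"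
    and delta: "AE x in lebesgue. basis_delta \<B>\<^sub>1 x f = 0"
    by (auto simp: F_plus_def)
  have diff: "differentiation_basis \<B>" using dens by (simp add: density_basis_def)
  have diff1: "differentiation_basis \<B>\<^sub>1" "\<B>\<^sub>1 \<subseteq> \<B>"
    and diff2: "differentiation_basis \<B>\<^sub>2" "\<B>\<^sub>2 \<subseteq> \<B>"
    using B1 B2 by (auto simp: subbasis_def)
  obtain c where c: "c \<ge> 1"
    and transfer: "\<And>g \<epsilon> d x. \<lbrakk>locally_integrable g; \<And>y. 0 \<le> g y; \<epsilon> > 0; d > 0;
      x \<in> small_mean_set \<B>\<^sub>1 g \<epsilon> d;
      basis_delta \<B> x (indicator (small_mean_set \<B>\<^sub>1 g \<epsilon> d)) = 0\<rbrakk>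
      \<Longrightarrow> eventually (\<lambda>R. mean R g \<le> c\<^sup>2 * \<epsilon>) (shrinking \<B>\<^sub>2 x)"
    using eventually_mean_le_of_density_point[OF diff op B1 B2 quasi] by metis
  define h where "h = (\<lambda>q x. min (f x) q)"
  define g where "g = (\<lambda>q x. f x - h q x)"
  define A where
    "A = (\<lambda>q (j::nat) (m::nat). small_mean_set \<B>\<^sub>1 (g q) (1 / Suc j) (1 / Suc m))"
  have h: "locally_integrable (h q)" for q
    unfolding h_def by (intro locally_integrable_min f locally_integrable_const)
  have g: "locally_integrable (g q)" for q
    unfolding g_def by (intro locally_integrable_diff f h)
  have g0: "0 \<le> g q y" for q y by (simp add: g_def h_def)
  have "A q j m \<in> sets lebesgue" for q j m
  proof -
    have "closed (A q j m)" unfolding A_def using op diff1 by (intro closed_small_mean_set) auto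
    then show ?thesis by (simp add: borel_closed)
  qed
  then have ae_A: "AE x in lebesgue. \<forall>(q::rat) j m. basis_delta \<B> x (indicator (A (of_rat q) j m)) = 0"
    unfolding AE_all_countable using dens by (auto simp: density_basis_def)
  (* Nonnegative levels keep the truncations nonnegative, as the lower bound requires; they
     suffice because q > f x \<ge> 0 at almost every x. *)
  have ae_h: "AE x in lebesgue. \<forall>q::rat. 0 \<le> (of_rat q :: real) \<longrightarrow>
      (\<forall>r<h (of_rat q) x. eventually (\<lambda>E. r < mean E (h (of_rat q))) (shrinking \<B> x))"
    unfolding AE_all_countable
  proof
    fix q :: rat
    show "AE x in lebesgue. 0 \<le> (of_rat q :: real) \<longrightarrow>
      (\<forall>r<h (of_rat q) x. eventually (\<lambda>E. r < mean E (h (of_rat q))) (shrinking \<B> x))"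
    proof (cases "0 \<le> (of_rat q :: real)")
      case True
      have "AE x in lebesgue. 0 \<le> h (of_rat q) x"
        using nonneg by eventually_elim (use True in \<open>simp add: h_def\<close>)
      from AE_eventually_less_mean[OF dens h this] show ?thesis by eventually_elim simp
    qed simp
  qed
  have "AE x in lebesgue. basis_delta \<B>\<^sub>2 x f = 0"
    using nonneg delta ae_A ae_h AE_eventually_less_mean[OF dens f nonneg]
  proof eventually_elim
    case (elim x)
    have ev2: "eventually (\<lambda>E. E \<in> \<B>\<^sub>2) (shrinking \<B>\<^sub>2 x)" by (rule eventually_shrinking_mem)
    have "((\<lambda>R. mean R f) \<longlongrightarrow> f x) (shrinking \<B>\<^sub>2 x)"
    proof (rule order_tendstoI)
      fix r assume "r < f x"
      with elim(5) have "eventually (\<lambda>E. r < mean E f) (shrinking \<B> x)" by blast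
      then show "eventually (\<lambda>E. r < mean E f) (shrinking \<B>\<^sub>2 x)"
        using filter_leD shrinking_mono[OF diff2(2)] by blast
    next
      fix t assume "f x < t"
      then obtain q :: rat where q: "f x < of_rat q" "of_rat q < t"
        using of_rat_dense by blast
      let ?q = "of_rat q :: real"
      have "0 \<le> ?q" using q elim(1) by linarith
      have "c\<^sup>2 > 0" using c by simp
      \<comment> \<open>The bounds \<open>?q\<close> and \<open>c\<^sup>2 / Suc j\<close> for the two summands have to add up to less than \<open>t\<close>.\<close>
      obtain j :: nat where j: "1 / real (Suc j) < (t - ?q) / c\<^sup>2"
        using nat_approx_posE[of "(t - ?q) / c\<^sup>2"] q \<open>c\<^sup>2 > 0\<close> by auto
      define e where "e = 1 / real (Suc j)"
      have "e > 0" by (simp add: e_def)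
      have "((\<lambda>E. mean E f) \<longlongrightarrow> f x) (shrinking \<B>\<^sub>1 x)"
        using elim(2) basis_delta_eq_0_iff[OF diff1(1)] by blast
      then have up: "eventually (\<lambda>E. mean E f < f x + e / 2) (shrinking \<B>\<^sub>1 x)"
        by (rule order_tendstoD(2)) (use \<open>e > 0\<close> in simp)
      have "h ?q x = f x" using q by (simp add: h_def)
      then have "f x - e / 2 < h ?q x" using \<open>e > 0\<close> by simp
      then have "eventually (\<lambda>E. f x - e / 2 < mean E (h ?q)) (shrinking \<B> x)"
        using elim(4) \<open>0 \<le> ?q\<close> by blast
      then have low: "eventually (\<lambda>E. f x - e / 2 < mean E (h ?q)) (shrinking \<B>\<^sub>1 x)"
        using filter_leD shrinking_mono[OF diff1(2)] by blast
      have "eventually (\<lambda>E. E \<in> \<B>\<^sub>1) (shrinking \<B>\<^sub>1 x)" by (rule eventually_shrinking_mem)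
      with up low have "eventually (\<lambda>E. mean E (g ?q) \<le> e) (shrinking \<B>\<^sub>1 x)"
      proof eventually_elim
        case (elim E)
        have "mean E (g ?q) = mean E f - mean E (h ?q)"
          unfolding g_def using basis_setD[OF diff1(1) elim(3)] by (intro mean_diff f h)
        with elim show ?case by linarith
      qed
      then obtain d where d: "d > 0" "\<And>E. E \<in> \<B>\<^sub>1 \<Longrightarrow> x \<in> E \<Longrightarrow> diameter E < d \<Longrightarrow> mean E (g ?q) \<le> e"
        unfolding eventually_shrinking[OF diff1(1)] by blast
      obtain m :: nat where m: "1 / real (Suc m) < d" using nat_approx_posE[OF d(1)] by blast
      have "x \<in> A ?q j m" using d(2) m by (auto simp: A_def small_mean_set_def e_def)
      moreover have "basis_delta \<B> x (indicator (A ?q j m)) = 0" using elim(3) by blast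
      ultimately have "eventually (\<lambda>R. mean R (g ?q) \<le> c\<^sup>2 * e) (shrinking \<B>\<^sub>2 x)"
        unfolding A_def e_def
        by (intro transfer[OF g g0]) auto
      with ev2 show "eventually (\<lambda>R. mean R f < t) (shrinking \<B>\<^sub>2 x)"
      proof eventually_elim
        case (elim R)
        note R = basis_setD[OF diff2(1) elim(1)]
        have "mean R (h ?q) \<le> mean R (\<lambda>_. ?q)"
          by (rule mean_mono_AE[OF R(1,2) h locally_integrable_const]) (simp add: h_def)
        then have "mean R (h ?q) \<le> ?q" by (simp add: mean_const[OF R])
        moreover have "mean R (g ?q) = mean R f - mean R (h ?q)"
          unfolding g_def by (intro mean_diff R f h)
        moreover have "c\<^sup>2 * e < t - ?q"
          using j \<open>c\<^sup>2 > 0\<close> unfolding e_def[symmetric] by (simp add: less_divide_eq mult.commute)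
        ultimately show ?case using elim(2) by linarith
      qed
    qed
    then show ?case using basis_delta_eq_0_iff[OF diff2(1)] by blast
  qed
  with f nonneg show "f \<in> F_plus \<B>\<^sub>2" by (simp add: F_plus_def)
qed

theorem theorem3p3:
  fixes \<B> \<B>\<^sub>1 \<B>\<^sub>2 :: "(real ^ 'n) set set"
  assumes "density_basis \<B>"
    and "\<forall>E\<in>\<B>. open E"
    and "subbasis \<B>\<^sub>1 \<B>"
    and "subbasis \<B>\<^sub>2 \<B>"
    and "quasi_equivalent \<B> \<B>\<^sub>1 \<B>\<^sub>2"
  shows "F_plus \<B>\<^sub>1 = F_plus \<B>\<^sub>2"
  using assms F_plus_subset_of_quasi_coverable[of \<B>]
  unfolding quasi_equivalent_def by (intro equalityI) auto

end
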